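(* Let $a,b$ be nonzero real numbers and let $n\ge 1$ be an integer. Then: (i) $$\sum_{k=0}^{n-1}\mathcal{F}_k(a,b)=\frac{a^{\varepsilon(n)}b^{1-\varepsilon(n)}\mathcal{F}_n(a,b)+a^{1-\varepsilon(n)}b^{\varepsilon(n)}\mathcal{F}_{n-1}(a,b)-a\mathcal{F}_1(a,b)+ab\,\mathcal{F}_0(a,b)-b\mathcal{F}_0(a,b)}{ab}.$$ (ii) For every nonzero real $x$ with $1-(ab+2)x^2+x^4\neq 0$, $$\sum_{k=0}^{n}\mathcal{F}_k(a,b)\,x^{-k}=\frac{1}{1-(ab+2)x^2+x^4}\Big\{\frac{\mathcal{F}_{n-1}(a,b)}{x^{n-1}}-\frac{\mathcal{F}_{n+1}(a,b)}{x^{n-3}}+\frac{\mathcal{F}_n(a,b)}{x^n}-\frac{\mathcal{F}_{n+2}(a,b)}{x^{n-2}}+x^4\mathcal{F}_0(a,b)+x^3\mathcal{F}_1(a,b)-x^2\left[(ab+1)\mathcal{F}_0(a,b)-a\mathcal{F}_1(a,b)\right]-x\left(\mathcal{F}_1(a,b)-b\mathcal{F}_0(a,b)\right)\Big\}.$$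
   Context: Fix nonzero real numbers $a,b$. The bi-periodic Fibonacci matrix sequence $(\mathcal{F}_n(a,b))_{n\ge 0}$ of $2\times 2$ real matrices is defined by $\mathcal{F}_0(a,b)=\begin{pmatrix}1&0\\0&1\end{pmatrix}$, $\mathcal{F}_1(a,b)=\begin{pmatrix}b&\frac{b}{a}\\1&0\end{pmatrix}$, and for $n\ge 2$: $\mathcal{F}_n(a,b)=a\mathcal{F}_{n-1}(a,b)+\mathcal{F}_{n-2}(a,b)$ if $n$ is even, $\mathcal{F}_n(a,b)=b\mathcal{F}_{n-1}(a,b)+\mathcal{F}_{n-2}(a,b)$ if $n$ is odd. The parity function is $\varepsilon(n)=n-2\lfloor n/2\rfloor$, i.e. $\varepsilon(n)=1$ if $n$ is odd and $0$ if $n$ is even. *)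

theory Defs
  imports "HOL-Analysis.Analysis"
begin

fun biperiodic_fib_matrix :: "real \<Rightarrow> real \<Rightarrow> nat \<Rightarrow> real^2^2" where
  "biperiodic_fib_matrix a b 0 = mat 1"
| "biperiodic_fib_matrix a b (Suc 0) = vector [vector [b, b / a], vector [1, 0]]"
| "biperiodic_fib_matrix a b (Suc (Suc n)) =
     (if even (Suc (Suc n)) then a else b) *\<^sub>R biperiodic_fib_matrix a b (Suc n)
       + biperiodic_fib_matrix a b n"

definition parity_fn :: "nat \<Rightarrow> nat" where
  "parity_fn n = n - 2 * (n div 2)"

end

theory Submission
  imports Defs
begin

text \<open>
  Both identities are linear in the matrix sequence, and each matrix entry is a scalar sequence
  with the same recurrence, so it suffices to prove them for scalar sequences over a field.

  The first sum telescopes: for \<open>n \<ge> 1\<close> the term \<open>a * b * f n\<close> is one of \<open>a\<close>, \<open>b\<close> times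
  \<open>f (n + 1) - f (n - 1)\<close>, because the recurrence makes this difference the other one times \<open>f n\<close>
  (\<open>biperiodic_sum\<close>). For the second, two steps of the recurrence use both coefficients once,
  whence \<open>f (n + 4) + f n = (a * b + 2) * f (n + 2)\<close> whatever the parity of \<open>n\<close>
  (\<open>biperiodic_step_two\<close>). So \<open>1 - (a * b + 2) * x\<^sup>2 + x ^ 4\<close> is the characteristic polynomial of
  this constant-coefficient recurrence, and multiplying the sum by it cancels everything except
  boundary terms (\<open>biperiodic_weighted_sum\<close>).
\<close>

lemma biperiodic_step_two:
  fixes f :: "nat \<Rightarrow> 'a::comm_ring_1"
  assumes rec: "\<And>n. f (n + 2) = (if even n then a else b) * f (n + 1) + f n"
  shows "f (n + 4) + f n = (a * b + 2) * f (n + 2)"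
proof -
  have idx: "n + 4 = (n + 2) + 2" "n + 3 = (n + 1) + 2"
    by simp_all
  have "f (n + 4) = (if even n then a else b) * f (n + 3) + f (n + 2)"
    unfolding idx using rec[of "n + 2"] by simp
  moreover have "f (n + 3) = (if even n then b else a) * f (n + 2) + f (n + 1)"
    unfolding idx using rec[of "n + 1"] by simp
  ultimately show ?thesis
    using rec[of n] by (simp add: algebra_simps)
qed

text \<open>
  Passing from \<open>m\<close> to \<open>m + 1\<close> exchanges the two coefficients, so \<open>f (m + 1)\<close> keeps its coefficient
  and cancels, and the increment is one coefficient times \<open>f (m + 2) - f m\<close>, which the recurrence
  turns into \<open>a * b * f (m + 1)\<close>.
\<close>

lemma biperiodic_sum:
  fixes f :: "nat \<Rightarrow> 'a::comm_ring_1"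
  assumes rec: "\<And>n. f (n + 2) = (if even n then a else b) * f (n + 1) + f n"
  shows "a * b * (\<Sum>k=0..m. f k) =
    (if even m then a else b) * f (m + 1) + (if even m then b else a) * f m
      - a * f 1 + a * b * f 0 - b * f 0"
proof (induction m)
  case 0
  show ?case by simp
next
  case (Suc m)
  then show ?case
    using rec[of m] by (simp add: algebra_simps)
qed

text \<open>
  The partial sums start at \<open>k = 0\<close>, where the four-step recurrence has no predecessors; the terms
  in \<open>f 0\<close> and \<open>f 1\<close> are what this lower end contributes. When \<open>m\<close> grows by one, the change of the
  right-hand side involves only \<open>f m\<close>, \<open>f (m + 2)\<close> and \<open>f (m + 4)\<close>, and \<open>biperiodic_step_two\<close>
  reduces it to a multiple of \<open>f (m + 2)\<close>, the next term of the sum.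
\<close>

lemma biperiodic_weighted_sum:
  fixes f :: "nat \<Rightarrow> 'a::field"
  assumes rec: "\<And>n. f (n + 2) = (if even n then a else b) * f (n + 1) + f n"
    and x: "x \<noteq> 0"
  shows "(1 - (a * b + 2) * x ^ 2 + x ^ 4) * (\<Sum>k=0..m + 1. f k / x ^ k) =
    (f m - x ^ 2 * f (m + 2) + f (m + 1) / x - x * f (m + 3)) / x ^ m
      + x ^ 4 * f 0 + x ^ 3 * f 1 - x ^ 2 * ((a * b + 1) * f 0 - a * f 1) - x * (f 1 - b * f 0)"
proof (induction m)
  case 0
  have f2: "f (Suc (Suc 0)) = a * f 1 + f 0"
    using rec[of 0] by simp
  have f3: "f 3 = b * f (Suc (Suc 0)) + f 1"
    using rec[of 1] by (simp add: numeral_3_eq_3)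
  show ?case
    using x by (simp add: f2 f3 field_simps power2_eq_square power3_eq_cube power4_eq_xxxx)
next
  case (Suc m)
  define D where "D = 1 - (a * b + 2) * x ^ 2 + x ^ 4"
  have f4: "f (m + 4) = (a * b + 2) * f (m + 2) - f m"
    using biperiodic_step_two[of f a b m, OF rec] by (simp add: algebra_simps)
  define P where
    "P k = (f k - x ^ 2 * f (k + 2) + f (k + 1) / x - x * f (k + 3)) / x ^ k" for k
  have "D * (f (m + 2) / x ^ (m + 2)) =
      (f (m + 1) - x ^ 2 * f (m + 3) + f (m + 2) / x - x * f (m + 4)) / x ^ (m + 1) - P m"
    unfolding f4 D_def P_def using x by (simp add: field_simps power_add eval_nat_numeral)
  also have "\<dots> = P (Suc m) - P m"
    by (simp add: P_def add.commute numeral_eq_Suc)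
  finally have incr: "D * (f (m + 2) / x ^ (m + 2)) = P (Suc m) - P m" .
  have split: "(\<Sum>k=0..Suc m + 1. f k / x ^ k) =
      (\<Sum>k=0..m + 1. f k / x ^ k) + f (m + 2) / x ^ (m + 2)"
    by simp
  show ?case
    using Suc.IH
    unfolding D_def[symmetric] P_def[symmetric] split distrib_left[of D] incr
    by (simp only:) (simp add: algebra_simps)
qed

lemma biperiodic_fib_matrix_entry_rec:
  "biperiodic_fib_matrix a b (n + 2) $ i $ j =
    (if even n then a else b) * biperiodic_fib_matrix a b (n + 1) $ i $ j
      + biperiodic_fib_matrix a b n $ i $ j"
  by simp

lemma parity_fn_eq: "parity_fn n = (if even n then 0 else 1)"
  by (simp add: parity_fn_def minus_mult_div_eq_mod odd_iff_mod_2_eq_one)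

theorem theorem2p7:
  fixes a b :: real and n :: nat
  assumes "a \<noteq> 0" and "b \<noteq> 0" and "n \<ge> 1"
  shows "(\<Sum>k=0..n-1. biperiodic_fib_matrix a b k) =
           (1 / (a * b)) *\<^sub>R
             ((a ^ parity_fn n * b ^ (1 - parity_fn n)) *\<^sub>R biperiodic_fib_matrix a b n
              + (a ^ (1 - parity_fn n) * b ^ parity_fn n) *\<^sub>R biperiodic_fib_matrix a b (n - 1)
              - a *\<^sub>R biperiodic_fib_matrix a b 1
              + (a * b) *\<^sub>R biperiodic_fib_matrix a b 0
              - b *\<^sub>R biperiodic_fib_matrix a b 0)
       \<and> (\<forall>x::real. x \<noteq> 0 \<longrightarrow> 1 - (a * b + 2) * x ^ 2 + x ^ 4 \<noteq> 0 \<longrightarrow>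
           (\<Sum>k=0..n. (x powi (- int k)) *\<^sub>R biperiodic_fib_matrix a b k) =
             (1 / (1 - (a * b + 2) * x ^ 2 + x ^ 4)) *\<^sub>R
               ((1 / x powi (int n - 1)) *\<^sub>R biperiodic_fib_matrix a b (n - 1)
                - (1 / x powi (int n - 3)) *\<^sub>R biperiodic_fib_matrix a b (n + 1)
                + (1 / x powi (int n)) *\<^sub>R biperiodic_fib_matrix a b n
                - (1 / x powi (int n - 2)) *\<^sub>R biperiodic_fib_matrix a b (n + 2)
                + x ^ 4 *\<^sub>R biperiodic_fib_matrix a b 0
                + x ^ 3 *\<^sub>R biperiodic_fib_matrix a b 1
                - x ^ 2 *\<^sub>R ((a * b + 1) *\<^sub>R biperiodic_fib_matrix a b 0
                              - a *\<^sub>R biperiodic_fib_matrix a b 1)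
                - x *\<^sub>R (biperiodic_fib_matrix a b 1 - b *\<^sub>R biperiodic_fib_matrix a b 0)))"
proof -
  obtain m where n: "n = m + 1"
    using \<open>n \<ge> 1\<close> by (metis add.commute le_Suc_ex)
  have sum: "(\<Sum>k=0..n-1. biperiodic_fib_matrix a b k) =
           (1 / (a * b)) *\<^sub>R
             ((a ^ parity_fn n * b ^ (1 - parity_fn n)) *\<^sub>R biperiodic_fib_matrix a b n
              + (a ^ (1 - parity_fn n) * b ^ parity_fn n) *\<^sub>R biperiodic_fib_matrix a b (n - 1)
              - a *\<^sub>R biperiodic_fib_matrix a b 1
              + (a * b) *\<^sub>R biperiodic_fib_matrix a b 0
              - b *\<^sub>R biperiodic_fib_matrix a b 0)" (is "?S = (1 / (a * b)) *\<^sub>R ?T")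
  proof -
    have "a * b * ?S $ i $ j = ?T $ i $ j" for i j
      using biperiodic_sum[of "\<lambda>k. biperiodic_fib_matrix a b k $ i $ j" a b m,
          OF biperiodic_fib_matrix_entry_rec]
      by (simp add: n parity_fn_eq del: biperiodic_fib_matrix.simps)
    then have "(a * b) *\<^sub>R ?S = ?T"
      by (simp add: vec_eq_iff del: sum_component)
    then have "(1 / (a * b)) *\<^sub>R ?T = (1 / (a * b)) *\<^sub>R (a * b) *\<^sub>R ?S"
      by simp
    with assms show ?thesis
      by simp
  qed
  have weighted: "(\<Sum>k=0..n. (x powi (- int k)) *\<^sub>R biperiodic_fib_matrix a b k) =
             (1 / (1 - (a * b + 2) * x ^ 2 + x ^ 4)) *\<^sub>R
               ((1 / x powi (int n - 1)) *\<^sub>R biperiodic_fib_matrix a b (n - 1)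
                - (1 / x powi (int n - 3)) *\<^sub>R biperiodic_fib_matrix a b (n + 1)
                + (1 / x powi (int n)) *\<^sub>R biperiodic_fib_matrix a b n
                - (1 / x powi (int n - 2)) *\<^sub>R biperiodic_fib_matrix a b (n + 2)
                + x ^ 4 *\<^sub>R biperiodic_fib_matrix a b 0
                + x ^ 3 *\<^sub>R biperiodic_fib_matrix a b 1
                - x ^ 2 *\<^sub>R ((a * b + 1) *\<^sub>R biperiodic_fib_matrix a b 0
                              - a *\<^sub>R biperiodic_fib_matrix a b 1)
                - x *\<^sub>R (biperiodic_fib_matrix a b 1 - b *\<^sub>R biperiodic_fib_matrix a b 0))"
    (is "?S = (1 / ?D) *\<^sub>R ?T")
    if x: "x \<noteq> 0" and D: "1 - (a * b + 2) * x ^ 2 + x ^ 4 \<noteq> 0" for x :: real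
  proof -
    have powi_diff: "1 / x powi (int n - int l) = x ^ l / x ^ n" for l
      using x by (simp add: power_int_diff)
    have powi: "1 / x powi (int n - 1) = 1 / x ^ m" "1 / x powi (int n - 3) = x ^ 2 / x ^ m"
        "1 / x powi int n = 1 / x / x ^ m" "1 / x powi (int n - 2) = x / x ^ m"
      using powi_diff[of 1] powi_diff[of 3] powi_diff[of 0] powi_diff[of 2] x
      by (simp_all add: n eval_nat_numeral)
    have entry: "?D * ?S $ i $ j = ?T $ i $ j" for i j
    proof -
      have "?S $ i $ j = (\<Sum>k=0..m + 1. biperiodic_fib_matrix a b k $ i $ j / x ^ k)"
        by (simp add: n power_int_minus divide_inverse mult.commute
            del: biperiodic_fib_matrix.simps sum.cl_ivl_Suc)
      moreover have "n - 1 = m" "n + 1 = m + 2" "n + 2 = m + 3"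
        by (simp_all add: n)
      ultimately show ?thesis
        using biperiodic_weighted_sum[of "\<lambda>k. biperiodic_fib_matrix a b k $ i $ j" a b x m,
            OF biperiodic_fib_matrix_entry_rec x]
        unfolding powi
        by (simp only: n vector_add_component vector_minus_component vector_scaleR_component
            real_scaleR_def)
          (simp add: diff_divide_distrib add_divide_distrib del: biperiodic_fib_matrix.simps)
    qed
    have "?D *\<^sub>R ?S = ?T"
      unfolding vec_eq_iff vector_scaleR_component real_scaleR_def using entry by blast
    then have "(1 / ?D) *\<^sub>R ?T = (1 / ?D) *\<^sub>R ?D *\<^sub>R ?S"
      by simp
    with D show ?thesis
      by simp
  qed
  from sum weighted show ?thesis
    by blast
qed

end
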